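(* Let $G$ be an infinite, locally finite, connected graph that is claw-free and net-free. Then precisely one of the following statements holds: (1) $G$ has exactly one end and admits a spanning ray. (2) $G$ has exactly two ends and admits a spanning double ray.
   Context: Graphs are undirected and simple, possibly infinite. A graph is locally finite if every vertex has finite degree. A graph is $H$-free if it has no induced subgraph isomorphic to $H$. The claw is $K_{1,3}$. The net is the graph on six vertices obtained from a triangle by attaching one new pendant (degree $1$) vertex to each of the three vertices of the triangle. A ray is a one-way infinite path; a double ray is a two-way infinite path (as subgraphs of $G$). Two rays in $G$ are equivalent if they cannot be separated by finitely many vertices, i.e. for every finite $S\subseteq V(G)$ they have tails in the same component of $G-S$; the ends of $G$ are the equivalence classes of rays. A ray or double ray is spanning if it contains all vertices of $G$. *)

theory Defs
  imports Main
begin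

record 'a ugraph =
  vertices :: "'a set"
  edges :: "'a set set"

definition simple_graph :: "'a ugraph \<Rightarrow> bool" where
  "simple_graph G \<longleftrightarrow> (\<forall>e\<in>edges G. e \<subseteq> vertices G \<and> card e = 2)"

definition adjacent :: "'a ugraph \<Rightarrow> 'a \<Rightarrow> 'a \<Rightarrow> bool" where
  "adjacent G u v \<longleftrightarrow> {u, v} \<in> edges G"

definition infinite_graph :: "'a ugraph \<Rightarrow> bool" where
  "infinite_graph G \<longleftrightarrow> infinite (vertices G)"

definition locally_finite_graph :: "'a ugraph \<Rightarrow> bool" where
  "locally_finite_graph G \<longleftrightarrow> (\<forall>v\<in>vertices G. finite {u. adjacent G v u})"

definition subgraph_of :: "'a ugraph \<Rightarrow> 'a ugraph \<Rightarrow> bool" where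
  "subgraph_of H G \<longleftrightarrow> vertices H \<subseteq> vertices G \<and> edges H \<subseteq> edges G"

definition induced_on :: "'a ugraph \<Rightarrow> 'a set \<Rightarrow> 'a ugraph" where
  "induced_on G W = \<lparr>vertices = vertices G \<inter> W, edges = {e \<in> edges G. e \<subseteq> W}\<rparr>"

definition delete_vertices :: "'a ugraph \<Rightarrow> 'a set \<Rightarrow> 'a ugraph" where
  "delete_vertices G S = induced_on G (vertices G - S)"

definition graph_isomorphic :: "'a ugraph \<Rightarrow> 'b ugraph \<Rightarrow> bool" where
  "graph_isomorphic G H \<longleftrightarrow>
     (\<exists>f. bij_betw f (vertices G) (vertices H) \<and>
          (\<forall>u\<in>vertices G. \<forall>v\<in>vertices G. adjacent G u v \<longleftrightarrow> adjacent H (f u) (f v)))"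

definition free_of :: "'b ugraph \<Rightarrow> 'a ugraph \<Rightarrow> bool" where
  "free_of H G \<longleftrightarrow> \<not> (\<exists>W\<subseteq>vertices G. graph_isomorphic (induced_on G W) H)"

definition claw :: "nat ugraph" where
  "claw = \<lparr>vertices = {0, 1, 2, 3}, edges = {{0, 1}, {0, 2}, {0, 3}}\<rparr>"

definition net :: "nat ugraph" where
  "net = \<lparr>vertices = {0, 1, 2, 3, 4, 5},
          edges = {{0, 1}, {1, 2}, {0, 2}, {0, 3}, {1, 4}, {2, 5}}\<rparr>"

definition connectivity :: "'a ugraph \<Rightarrow> ('a \<times> 'a) set" where
  "connectivity G =
     {(u, v). u \<in> vertices G \<and> v \<in> vertices G \<and> (adjacent G)\<^sup>*\<^sup>* u v}"

definition connected_graph :: "'a ugraph \<Rightarrow> bool" where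
  "connected_graph G \<longleftrightarrow>
     vertices G \<noteq> {} \<and> (\<forall>u\<in>vertices G. \<forall>v\<in>vertices G. (u, v) \<in> connectivity G)"

text \<open>Components are represented by their vertex sets.\<close>

definition graph_components :: "'a ugraph \<Rightarrow> 'a set set" where
  "graph_components G = vertices G // connectivity G"

text \<open>
  Rays and double rays are graphs, not sequences: different enumerations of the same
  double ray (by shift or reflection) give the same object.
\<close>

definition ray_graph :: "(nat \<Rightarrow> 'a) \<Rightarrow> 'a ugraph" where
  "ray_graph x = \<lparr>vertices = range x, edges = range (\<lambda>i. {x i, x (i + 1)})\<rparr>"

definition double_ray_graph :: "(int \<Rightarrow> 'a) \<Rightarrow> 'a ugraph" where
  "double_ray_graph x = \<lparr>vertices = range x, edges = range (\<lambda>i. {x i, x (i + 1)})\<rparr>"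

definition ray_in :: "'a ugraph \<Rightarrow> 'a ugraph \<Rightarrow> bool" where
  "ray_in G R \<longleftrightarrow> subgraph_of R G \<and> (\<exists>x. inj x \<and> R = ray_graph x)"

definition double_ray_in :: "'a ugraph \<Rightarrow> 'a ugraph \<Rightarrow> bool" where
  "double_ray_in G D \<longleftrightarrow> subgraph_of D G \<and> (\<exists>x. inj x \<and> D = double_ray_graph x)"

definition spanning_in :: "'a ugraph \<Rightarrow> 'a ugraph \<Rightarrow> bool" where
  "spanning_in G H \<longleftrightarrow> vertices H = vertices G"

definition tail_of_ray :: "'a ugraph \<Rightarrow> 'a ugraph \<Rightarrow> bool" where
  "tail_of_ray T R \<longleftrightarrow>
     (\<exists>x n. inj x \<and> R = ray_graph x \<and> T = ray_graph (\<lambda>i. x (n + i)))"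

definition ray_equivalence :: "'a ugraph \<Rightarrow> ('a ugraph \<times> 'a ugraph) set" where
  "ray_equivalence G =
     {(R, R'). ray_in G R \<and> ray_in G R' \<and>
        (\<forall>S. finite S \<and> S \<subseteq> vertices G \<longrightarrow>
           (\<exists>C\<in>graph_components (delete_vertices G S).
              \<exists>T T'. tail_of_ray T R \<and> tail_of_ray T' R' \<and>
                vertices T \<subseteq> C \<and> vertices T' \<subseteq> C))}"

definition graph_ends :: "'a ugraph \<Rightarrow> 'a ugraph set set" where
  "graph_ends G = {R. ray_in G R} // ray_equivalence G"

end

theory Submission
  imports Defs
begin

text \<open>
  Why the theorem holds.  Say that a path dominates a vertex that lies on it or is adjacent to it,
  and let \<open>x\<close> be any induced ray; one exists because geodesics from a fixed vertex, followed to
  infinity by Koenig's lemma, are induced.  The proof rests on two observations.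

  The first one turns domination into spanning and comes from claw-freeness.  Suppose that an induced
  ray or double ray \<open>x\<close> dominates the graph, and put every vertex off \<open>x\<close> into the block \<open>K i\<close> of its
  last neighbour \<open>x i\<close>.  Claws centred at \<open>x i\<close> with \<open>x (i + 1)\<close> as a leaf show that \<open>K i\<close> is
  a clique and that its members are adjacent to \<open>x (i - 1)\<close>, if there is one, as well.  Hence \<open>x (i - 1)\<close>, then
  \<open>K i\<close> in any order, then \<open>x i\<close>, and so on, is a spanning ray or double ray
  (\<open>blocks_along_path\<close>).

  The second one says where domination can fail (\<open>attached_at_start\<close>).  If a vertex \<open>u\<close> has a
  neighbour on an induced ray \<open>x\<close> and also a neighbour \<open>w\<close> that \<open>x\<close> does not dominate, then \<open>u\<close>
  sees either \<open>x 0\<close> alone or exactly \<open>x 0\<close> and \<open>x 1\<close>: every other pattern gives a claw, or a net on the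
  triangle of \<open>u\<close> and two consecutive vertices of \<open>x\<close>.  In particular an induced double ray, which
  has no start, dominates everything.

  Let \<open>U\<close> be the set of vertices not dominated by \<open>x\<close>.  Its outer boundary consists of neighbours of
  \<open>x 0\<close>, so it is finite.

  If \<open>U\<close> is infinite, some boundary vertex starts an induced ray that continues inside \<open>U\<close>.  Glued to
  \<open>x\<close> it yields an induced double ray, which dominates and so gives a spanning double ray.  Its two
  halves are separated by the boundary of \<open>U\<close>, and domination forces every ray into the end of one of
  the halves, so there are exactly two ends.

  If \<open>U\<close> is finite, \<open>x\<close> can be changed at its start, by putting a boundary vertex in front of \<open>x 0\<close> or
  in place of it, so that strictly fewer vertices are undominated (\<open>fewer_undominated\<close>).  Repeating
  this gives a dominating induced ray, hence a spanning ray and a single end.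
\<close>

section \<open>Concatenating finite blocks\<close>

text \<open>
  The initial segments of the infinite concatenation are finite lists that extend one another, so the
  \<open>n\<close>-th entry of any segment that is long enough can serve as the \<open>n\<close>-th vertex of the ray.
\<close>
lemma ray_of_blocks:
  fixes L :: "nat \<Rightarrow> 'a list"
  assumes ne: "\<And>i. L i \<noteq> []" and dist: "\<And>i. distinct (L i)"
    and disj: "\<And>i j. i \<noteq> j \<Longrightarrow> set (L i) \<inter> set (L j) = {}"
    and succ: "\<And>i. successively E (L i)"
    and link: "\<And>i. E (last (L i)) (hd (L (Suc i)))"
  shows "\<exists>f. inj f \<and> range f = (\<Union>i. set (L i)) \<and> f 0 = hd (L 0) \<and> (\<forall>n. E (f n) (f (Suc n)))"
proof -
  define c where "c n = concat (map L [0..<n])" for n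
  have c_Suc: "c (Suc n) = c n @ L n" for n by (simp add: c_def)
  have set_c: "set (c n) = (\<Union>i<n. set (L i))" for n by (auto simp: c_def)
  have dist_c: "distinct (c n)" for n
  proof (induction n)
    case (Suc n)
    have "set (L i) \<inter> set (L n) = {}" if "i < n" for i using disj[of i n] that by simp
    then have "set (c n) \<inter> set (L n) = {}" unfolding set_c by blast
    then show ?case using Suc dist by (simp add: c_Suc)
  qed (simp add: c_def)
  have last_c: "last (c (Suc n)) = last (L n)" for n using ne by (simp add: c_Suc)
  have succ_c: "successively E (c (Suc n))" for n
  proof (induction n)
    case 0 then show ?case using succ by (simp add: c_def)
  next
    case (Suc n)
    then show ?case using succ link last_c
      by (simp add: c_Suc[of "Suc n"] successively_append_iff)
  qed
  have len_c: "n \<le> length (c n)" for n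
  proof (induction n)
    case (Suc n)
    then show ?case using ne[of n] by (cases "L n") (auto simp: c_Suc)
  qed simp
  define f where "f n = c (Suc n) ! n" for n
  have c_nth: "c n ! k = c m ! k \<and> k < length (c n)" if "m \<le> n" "k < length (c m)" for k m n
    using that by (induction rule: dec_induct) (auto simp: c_Suc nth_append)
  have f_eq: "f k = c m ! k" if "k < length (c m)" for k m
    using c_nth[of m "max m (Suc k)" k] c_nth[of "Suc k" "max m (Suc k)" k] that len_c[of "Suc k"]
    by (simp add: f_def)
  show ?thesis
  proof (intro exI[of _ f] conjI allI)
    show "inj f"
    proof (rule injI)
      fix a b assume "f a = f b"
      define n where "n = Suc (max a b)"
      have l: "a < length (c n)" "b < length (c n)" using len_c[of n] by (auto simp: n_def)
      with \<open>f a = f b\<close> have "c n ! a = c n ! b" by (simp add: f_eq)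
      then show "a = b" using l dist_c nth_eq_iff_index_eq by blast
    qed
    show "range f = (\<Union>i. set (L i))"
    proof (intro equalityI subsetI)
      fix v assume "v \<in> range f"
      then obtain k where "v = f k" by auto
      then have "v \<in> set (c (Suc k))" using len_c[of "Suc k"] by (simp add: f_def)
      then show "v \<in> (\<Union>i. set (L i))" by (auto simp: set_c)
    next
      fix v assume "v \<in> (\<Union>i. set (L i))"
      then obtain i where "v \<in> set (c (Suc i))" by (auto simp: set_c)
      then obtain k where "k < length (c (Suc i))" "v = c (Suc i) ! k" by (metis in_set_conv_nth)
      then have "v = f k" by (simp add: f_eq)
      then show "v \<in> range f" by blast
    qed
    show "f 0 = hd (L 0)" using ne[of 0] by (simp add: f_def c_def hd_conv_nth)
    show "E (f n) (f (Suc n))" for n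
    proof -
      have l: "Suc n < length (c (Suc (Suc n)))" using len_c[of "Suc (Suc n)"] by simp
      show ?thesis
        using succ_c[of "Suc n"] l f_eq[OF l] f_eq[OF Suc_lessD[OF l]]
        by (simp add: successively_conv_nth)
    qed
  qed
qed

text \<open>
  The blocks with index at least \<open>0\<close> form one ray.  The remaining blocks, taken in descending order and
  each reversed, form another one, and the two are joined at their first vertices.
\<close>
lemma double_ray_of_blocks:
  fixes L :: "int \<Rightarrow> 'a list"
  assumes ne: "\<And>i. L i \<noteq> []" and dist: "\<And>i. distinct (L i)"
    and disj: "\<And>i j. i \<noteq> j \<Longrightarrow> set (L i) \<inter> set (L j) = {}"
    and succ: "\<And>i. successively E (L i)"
    and link: "\<And>i. E (last (L i)) (hd (L (i + 1)))"
    and sym: "\<And>u v. E u v \<Longrightarrow> E v u"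
  shows "\<exists>f :: int \<Rightarrow> 'a. inj f \<and> range f = (\<Union>i. set (L i)) \<and> (\<forall>n. E (f n) (f (n + 1)))"
proof -
  have E_sym: "E u v = E v u" for u v using sym by blast
  have "\<exists>f. inj f \<and> range f = (\<Union>i. set (L (int i))) \<and> f 0 = hd (L (int 0))
      \<and> (\<forall>n. E (f n) (f (Suc n)))"
  proof (rule ray_of_blocks)
    show "E (last (L (int i))) (hd (L (int (Suc i))))" for i
      using link[of "int i"] by (simp add: add.commute)
  qed (use ne dist disj succ in auto)
  then obtain f where f: "inj f" "range f = (\<Union>i. set (L (int i)))" "f 0 = hd (L 0)"
    "\<And>n. E (f n) (f (Suc n))"
    by auto
  have disj': "set (rev (L (- 1 - int i))) \<inter> set (rev (L (- 1 - int j))) = {}" if "i \<noteq> j" for i j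
    using disj[of "- 1 - int i" "- 1 - int j"] that by simp
  have succ': "successively E (rev (L (- 1 - int i)))" for i
    using succ[of "- 1 - int i"] by (simp add: E_sym)
  have link': "E (last (rev (L (- 1 - int i)))) (hd (rev (L (- 1 - int (Suc i)))))" for i
  proof -
    have "- 1 - int (Suc i) = - 2 - int i" "- 2 - int i + 1 = - 1 - int i" by simp_all
    then show ?thesis
      using sym[OF link[of "- 2 - int i"]] ne by (simp add: last_rev hd_rev)
  qed
  have "\<exists>g. inj g \<and> range g = (\<Union>i. set (rev (L (- 1 - int i))))
      \<and> g 0 = hd (rev (L (- 1 - int 0))) \<and> (\<forall>n. E (g n) (g (Suc n)))"
    by (rule ray_of_blocks[where E = E and L = "\<lambda>i. rev (L (- 1 - int i))", OF _ _ disj' succ' link'])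
      (simp_all add: ne dist)
  then obtain g where g: "inj g" "range g = (\<Union>i. set (rev (L (- 1 - int i))))"
    "g 0 = hd (rev (L (- 1 - int 0)))" "\<And>n. E (g n) (g (Suc n))"
    by blast
  have rg: "range g = (\<Union>i. set (L (- 1 - int i)))" and g0: "g 0 = last (L (- 1))"
    using g(2,3) by (simp_all add: hd_rev)
  define h where "h i = (if 0 \<le> i then f (nat i) else g (nat (- 1 - i)))" for i
  have fg: "f m \<noteq> g n" for m n
  proof -
    have "f m \<in> (\<Union>i. set (L (int i)))" "g n \<in> (\<Union>i. set (L (- 1 - int i)))"
      unfolding f(2)[symmetric] rg[symmetric] by simp_all
    then obtain i j where "f m \<in> set (L (int i))" "g n \<in> set (L (- 1 - int j))"
      by blast
    then show ?thesis using disj[of "int i" "- 1 - int j"] by auto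
  qed
  show ?thesis
  proof (intro exI[of _ h] conjI allI)
    show "inj h"
    proof (rule injI)
      fix i j assume "h i = h j"
      then show "i = j"
        using f(1) g(1) fg[of "nat i" "nat (- 1 - j)"] fg[of "nat j" "nat (- 1 - i)"]
        by (auto simp: h_def inj_eq split: if_splits)
    qed
    show "range h = (\<Union>i. set (L i))"
    proof (intro equalityI subsetI)
      fix v assume "v \<in> range h"
      then have "v \<in> range f \<or> v \<in> range g" by (auto simp: h_def split: if_splits)
      then show "v \<in> (\<Union>i. set (L i))" unfolding f(2) rg by blast
    next
      fix v assume "v \<in> (\<Union>i. set (L i))"
      then obtain i where i: "v \<in> set (L i)" by auto
      show "v \<in> range h"
      proof (cases "0 \<le> i")
        case True
        then have "v \<in> range f" using i unfolding f(2) by (auto intro!: exI[of _ "nat i"])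
        then obtain n where "v = f n" by auto
        then have "v = h (int n)" by (simp add: h_def)
        then show ?thesis by blast
      next
        case False
        then have "v \<in> range g" using i unfolding rg by (auto intro!: exI[of _ "nat (- 1 - i)"])
        then obtain n where "v = g n" by auto
        then have "v = h (- 1 - int n)" by (simp add: h_def)
        then show ?thesis by blast
      qed
    qed
    show "E (h n) (h (n + 1))" for n
    proof -
      consider "0 \<le> n" | "n = - 1" | "n < - 1" by linarith
      then show ?thesis
      proof cases
        case 1
        then show ?thesis using f(4)[of "nat n"] by (simp add: h_def nat_add_distrib)
      next
        case 2
        then show ?thesis using link[of "- 1"] f(3) g0 by (simp add: h_def)
      next
        case 3
        have "Suc (nat (- 2 - n)) = nat (- 1 - n)" "- 1 - (n + 1) = - 2 - n" using 3 by simp_all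
        then show ?thesis using sym[OF g(4)[of "nat (- 2 - n)"]] 3 by (simp add: h_def)
      qed
    qed
  qed
qed

lemma successively_if_clique:
  assumes "\<And>u v. u \<in> set xs \<Longrightarrow> v \<in> set xs \<Longrightarrow> u \<noteq> v \<Longrightarrow> E u v" "distinct xs"
  shows "successively E xs"
  using assms by (auto simp: successively_conv_nth nth_eq_iff_index_eq)

section \<open>Koenig's lemma for shortest paths\<close>

text \<open>
  Call a vertex good if infinitely many vertices are reached from it along edges that increase the
  distance from \<open>u\<close>.  Since out-degrees are finite, every good vertex has a good out-neighbour one step
  further away.  Distances grow by one along the resulting ray, so no edge skips a vertex in the forward
  direction.  The relation is directed because the lemma is also applied to steps into a given set.
\<close>
lemma geodesic_ray:
  fixes E :: "'a \<Rightarrow> 'a \<Rightarrow> bool"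
  assumes fin: "\<And>v. finite {w. E v w}" and inf: "infinite {w. E\<^sup>*\<^sup>* u w}"
  obtains x :: "nat \<Rightarrow> 'a" where "x 0 = u" "\<And>i. E (x i) (x (Suc i))"
    "\<And>i j. E (x i) (x j) \<Longrightarrow> j \<le> Suc i"
proof -
  define d where "d w = (LEAST n. (E ^^ n) u w)" for w
  \<comment> \<open>The edges lying on shortest paths from \<open>u\<close>.\<close>
  define F where "F v w \<longleftrightarrow> E\<^sup>*\<^sup>* u v \<and> E v w \<and> d w = Suc (d v)" for v w
  have d: "(E ^^ d w) u w" if "E\<^sup>*\<^sup>* u w" for w
  proof -
    have "\<exists>n. (E ^^ n) u w" using that by (simp add: rtranclp_power)
    then show ?thesis unfolding d_def by (rule LeastI_ex)
  qed
  have d_le: "d w \<le> n" if "(E ^^ n) u w" for n w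
    unfolding d_def using that by (rule Least_le)
  have d_step: "d w \<le> Suc (d v)" if "E\<^sup>*\<^sup>* u v" "E v w" for v w
    using d_le d[OF that(1)] that(2) by (metis relpowp_Suc_I)
  have reach: "F\<^sup>*\<^sup>* u w" if "E\<^sup>*\<^sup>* u w" for w
    using that
  proof (induction "d w" arbitrary: w)
    case 0
    then show ?case using d[of w] by simp
  next
    case (Suc n)
    obtain v where v: "(E ^^ n) u v" "E v w" using d[OF Suc.prems] Suc.hyps(2) by (metis relpowp_Suc_E)
    have uv: "E\<^sup>*\<^sup>* u v" using v(1) by (metis rtranclp_power)
    have "d v = n" using d_le[OF v(1)] d_step[OF uv v(2)] Suc.hyps(2) by simp
    then have "F\<^sup>*\<^sup>* u v" "F v w"
      using Suc.hyps uv v(2) by (simp_all add: F_def)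
    then show ?case by simp
  qed
  define good where "good v \<longleftrightarrow> E\<^sup>*\<^sup>* u v \<and> infinite {w. F\<^sup>*\<^sup>* v w}" for v
  have good_u: "good u"
  proof -
    have "{w. E\<^sup>*\<^sup>* u w} \<subseteq> {w. F\<^sup>*\<^sup>* u w}" using reach by blast
    then have "infinite {w. F\<^sup>*\<^sup>* u w}" using inf by (meson finite_subset)
    then show ?thesis by (simp add: good_def)
  qed
  have good_step: "\<exists>w. good w \<and> F v w" if "good v" for v
  proof (rule ccontr)
    assume "\<nexists>w. good w \<and> F v w"
    then have "finite {t. F\<^sup>*\<^sup>* w t}" if "F v w" for w
    proof -
      have "E\<^sup>*\<^sup>* u w" using that by (meson F_def rtranclp.rtrancl_into_rtrancl)
      then show ?thesis using that \<open>\<nexists>w. good w \<and> F v w\<close> by (auto simp: good_def)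
    qed
    moreover have "finite {w. F v w}" using fin[of v] by (rule finite_subset[rotated]) (auto simp: F_def)
    ultimately have "finite (insert v (\<Union>w\<in>{w. F v w}. {t. F\<^sup>*\<^sup>* w t}))" by auto
    moreover have "{w. F\<^sup>*\<^sup>* v w} \<subseteq> insert v (\<Union>w\<in>{w. F v w}. {t. F\<^sup>*\<^sup>* w t})"
      by (blast elim: converse_rtranclpE)
    ultimately have "finite {w. F\<^sup>*\<^sup>* v w}" by (rule finite_subset[rotated])
    then show False using that by (simp add: good_def)
  qed
  obtain x where x: "\<And>n. good (x n) \<and> (n = 0 \<longrightarrow> x n = u)" "\<And>n. F (x n) (x (Suc n))"
  proof -
    have "\<exists>x. \<forall>n::nat. (good (x n) \<and> (n = 0 \<longrightarrow> x n = u)) \<and> F (x n) (x (Suc n))"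
    proof (rule dependent_nat_choice)
      show "\<exists>v. good v \<and> ((0::nat) = 0 \<longrightarrow> v = u)" using good_u by blast
      show "\<exists>w. (good w \<and> (Suc n = 0 \<longrightarrow> w = u)) \<and> F v w" if "good v \<and> (n = 0 \<longrightarrow> v = u)" for v n
        using good_step[of v] that by blast
    qed
    then show thesis using that by blast
  qed
  have "d u = 0" using d_le[of 0 u] by simp
  then have dx: "d (x n) = n" for n
  proof (induction n)
    case 0 then show ?case using x(1)[of 0] by simp
  next
    case (Suc n) then show ?case using x(2)[of n] by (simp add: F_def)
  qed
  show thesis
  proof
    show "x 0 = u" using x(1) by simp
    show "E (x i) (x (Suc i))" for i using x(2) by (simp add: F_def)
    show "j \<le> Suc i" if "E (x i) (x j)" for i j
      using d_step[of "x i" "x j"] that x(1)[of i] by (simp add: good_def dx)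
  qed
qed

section \<open>Locally finite connected graphs\<close>

locale locally_finite_connected =
  fixes G :: "'a ugraph"
  assumes simple: "simple_graph G" and locfin: "locally_finite_graph G"
    and connected: "connected_graph G"
begin

abbreviation V :: "'a set" where "V \<equiv> vertices G"

abbreviation adj :: "'a \<Rightarrow> 'a \<Rightarrow> bool"  (infix "\<sim>" 50) where "u \<sim> v \<equiv> adjacent G u v"

lemma adj_sym: "u \<sim> v \<Longrightarrow> v \<sim> u"
  by (simp add: adjacent_def insert_commute)

lemma adj_commute: "u \<sim> v \<longleftrightarrow> v \<sim> u"
  using adj_sym by blast

lemma adj_irrefl [simp]: "\<not> v \<sim> v"
  using simple by (auto simp: adjacent_def simple_graph_def)

lemma adj_vertices: "u \<sim> v \<Longrightarrow> u \<in> V \<and> v \<in> V"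
  using simple by (auto simp: adjacent_def simple_graph_def)

lemma finite_neighbours: "finite {u. v \<sim> u}"
proof (cases "v \<in> V")
  case True
  then show ?thesis using locfin by (simp add: locally_finite_graph_def)
next
  case False
  then have "{u. v \<sim> u} = {}" using adj_vertices by blast
  then show ?thesis by simp
qed

lemma reachable: "u \<in> V \<Longrightarrow> v \<in> V \<Longrightarrow> (\<sim>)\<^sup>*\<^sup>* u v"
  using connected by (auto simp: connected_graph_def connectivity_def)

section \<open>Rays and ends\<close>

definition is_ray :: "(nat \<Rightarrow> 'a) \<Rightarrow> bool" where
  "is_ray x \<longleftrightarrow> inj x \<and> (\<forall>i. x i \<sim> x (Suc i))"

definition joined_avoiding :: "'a set \<Rightarrow> 'a \<Rightarrow> 'a \<Rightarrow> bool" where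
  "joined_avoiding S u v \<longleftrightarrow> (u, v) \<in> connectivity (delete_vertices G S)"

text \<open>
  Equivalence of rays expressed through their enumerations; \<open>ray_equivalence_iff\<close> relates it to the
  equivalence of rays as graphs.
\<close>
definition same_end :: "(nat \<Rightarrow> 'a) \<Rightarrow> (nat \<Rightarrow> 'a) \<Rightarrow> bool" where
  "same_end x y \<longleftrightarrow>
     (\<forall>S. finite S \<and> S \<subseteq> V \<longrightarrow> (\<exists>N. \<forall>i\<ge>N. \<forall>j\<ge>N. joined_avoiding S (x i) (y j)))"

lemma joined_iff:
  "joined_avoiding S u v \<longleftrightarrow> u \<in> V - S \<and> v \<in> V - S \<and> (\<lambda>a b. a \<sim> b \<and> a \<notin> S \<and> b \<notin> S)\<^sup>*\<^sup>* u v"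
proof -
  have "adjacent (delete_vertices G S) = (\<lambda>a b. a \<sim> b \<and> a \<notin> S \<and> b \<notin> S)"
    using adj_vertices by (fastforce simp: fun_eq_iff adjacent_def delete_vertices_def induced_on_def)
  then show ?thesis
    by (auto simp: joined_avoiding_def connectivity_def) (auto simp: delete_vertices_def induced_on_def)
qed

lemma joined_refl: "v \<in> V \<Longrightarrow> v \<notin> S \<Longrightarrow> joined_avoiding S v v"
  by (simp add: joined_iff)

lemma joined_adj: "u \<sim> v \<Longrightarrow> u \<notin> S \<Longrightarrow> v \<notin> S \<Longrightarrow> joined_avoiding S u v"
  using adj_vertices by (auto simp: joined_iff)

lemma joined_sym:
  assumes "joined_avoiding S u v" shows "joined_avoiding S v u"
proof -
  have "symp (\<lambda>a b. a \<sim> b \<and> a \<notin> S \<and> b \<notin> S)\<^sup>*\<^sup>*"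
    by (rule symp_rtranclp) (auto simp: symp_def adj_commute)
  then show ?thesis using assms by (auto simp: joined_iff dest: sympD)
qed

lemma joined_trans: "joined_avoiding S u v \<Longrightarrow> joined_avoiding S v w \<Longrightarrow> joined_avoiding S u w"
  by (auto simp: joined_iff)

lemma joined_mono: "S \<subseteq> S' \<Longrightarrow> joined_avoiding S' u v \<Longrightarrow> joined_avoiding S u v"
  unfolding joined_iff using rtranclp_mono[of "\<lambda>a b. a \<sim> b \<and> a \<notin> S' \<and> b \<notin> S'" "\<lambda>a b. a \<sim> b \<and> a \<notin> S \<and> b \<notin> S"]
  by (auto simp: le_fun_def)

text \<open>
  How a finite set is shown to separate two rays: if the only edges leaving \<open>U\<close> end in \<open>S\<close>, nothing
  outside \<open>U\<close> is joined to \<open>U\<close> when \<open>S\<close> is deleted.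
\<close>
lemma joined_stays_inside:
  assumes "joined_avoiding S u v" "u \<in> U" and closed: "\<And>a b. a \<in> U \<Longrightarrow> a \<sim> b \<Longrightarrow> b \<notin> S \<Longrightarrow> b \<in> U"
  shows "v \<in> U"
proof -
  have "(\<lambda>a b. a \<sim> b \<and> a \<notin> S \<and> b \<notin> S)\<^sup>*\<^sup>* u v" using assms(1) by (simp add: joined_iff)
  then show ?thesis using assms(2) by induction (auto intro: closed)
qed

lemma inj_leaves_finite_set:
  assumes "inj (x :: nat \<Rightarrow> 'b)" "finite F"
  shows "\<exists>N. \<forall>i\<ge>N. x i \<notin> F"
proof -
  have "finite {i. x i \<in> F}" using finite_vimageI[OF assms(2,1)] by (simp add: vimage_def)
  then obtain N where "\<forall>i\<in>{i. x i \<in> F}. i < N" by (metis finite_nat_set_iff_bounded)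
  then show ?thesis by (metis mem_Collect_eq leD)
qed

lemma ray_vertices: "is_ray x \<Longrightarrow> x i \<in> V"
  using adj_vertices by (auto simp: is_ray_def)

lemma joined_along_tail:
  assumes "\<And>i. i \<ge> N \<Longrightarrow> x i \<notin> S" "is_ray x" "i \<ge> N" "j \<ge> N"
  shows "joined_avoiding S (x i) (x j)"
proof -
  have "joined_avoiding S (x N) (x k)" if "k \<ge> N" for k
    using that
  proof (induction rule: dec_induct)
    case base
    show ?case using assms ray_vertices by (simp add: joined_refl)
  next
    case (step k)
    have "joined_avoiding S (x k) (x (Suc k))" using assms(1,2) step(1) by (simp add: joined_adj is_ray_def)
    then show ?case using step joined_trans by blast
  qed
  then show ?thesis using assms(3,4) joined_sym joined_trans by blast
qed

lemma same_end_refl: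
  assumes "is_ray x" shows "same_end x x"
  unfolding same_end_def
proof (intro allI impI)
  fix S assume "finite S \<and> S \<subseteq> V"
  then obtain N where "\<And>i. i \<ge> N \<Longrightarrow> x i \<notin> S"
    using inj_leaves_finite_set[of x S] assms by (auto simp: is_ray_def)
  then show "\<exists>N. \<forall>i\<ge>N. \<forall>j\<ge>N. joined_avoiding S (x i) (x j)"
    using joined_along_tail[of N x S] assms by blast
qed

lemma same_end_sym:
  assumes "same_end x y" shows "same_end y x"
  unfolding same_end_def
proof (intro allI impI)
  fix S assume "finite S \<and> S \<subseteq> V"
  then obtain N where N: "\<forall>i\<ge>N. \<forall>j\<ge>N. joined_avoiding S (x i) (y j)"
    using assms by (auto simp: same_end_def)
  have "joined_avoiding S (y i) (x j)" if "i \<ge> N" "j \<ge> N" for i j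
    using N that joined_sym[of S "x j" "y i"] by simp
  then show "\<exists>N. \<forall>i\<ge>N. \<forall>j\<ge>N. joined_avoiding S (y i) (x j)" by blast
qed

lemma same_end_trans:
  assumes "same_end x y" "same_end y z" shows "same_end x z"
  unfolding same_end_def
proof (intro allI impI)
  fix S assume S: "finite S \<and> S \<subseteq> V"
  obtain N where N: "\<forall>i\<ge>N. \<forall>j\<ge>N. joined_avoiding S (x i) (y j)" using assms(1) S by (auto simp: same_end_def)
  obtain M where M: "\<forall>i\<ge>M. \<forall>j\<ge>M. joined_avoiding S (y i) (z j)" using assms(2) S by (auto simp: same_end_def)
  have "joined_avoiding S (x i) (z j)" if "i \<ge> max N M" "j \<ge> max N M" for i j
    using that N[rule_format, of i "max N M"] M[rule_format, of "max N M" j]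
      joined_trans[of S "x i" "y (max N M)" "z j"] by simp
  then show "\<exists>N. \<forall>i\<ge>N. \<forall>j\<ge>N. joined_avoiding S (x i) (z j)" by blast
qed

lemma ray_in_iff: "ray_in G R \<longleftrightarrow> (\<exists>x. is_ray x \<and> R = ray_graph x)"
proof
  assume "ray_in G R"
  then obtain x where x: "inj x" "R = ray_graph x" "edges R \<subseteq> edges G"
    by (auto simp: ray_in_def subgraph_of_def)
  then have "is_ray x" by (auto simp: is_ray_def ray_graph_def adjacent_def)
  then show "\<exists>x. is_ray x \<and> R = ray_graph x" using x by blast
next
  assume "\<exists>x. is_ray x \<and> R = ray_graph x"
  then obtain x where x: "is_ray x" "R = ray_graph x" by blast
  have "subgraph_of R G"
    using x ray_vertices[of x] by (auto simp: subgraph_of_def ray_graph_def is_ray_def adjacent_def)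
  then show "ray_in G R" using x by (auto simp: ray_in_def is_ray_def)
qed

text \<open>
  A tail may be cut off from a different enumeration of the same ray.  This does no harm, since any tail
  omits only finitely many vertices of the ray.
\<close>
lemma eventually_in_tail:
  assumes "tail_of_ray T (ray_graph x)" "inj x" "vertices T \<subseteq> C"
  shows "\<exists>N. \<forall>i\<ge>N. x i \<in> C"
proof -
  obtain y n where y: "inj y" "ray_graph x = ray_graph y" "T = ray_graph (\<lambda>i. y (n + i))"
    using assms(1) by (auto simp: tail_of_ray_def)
  have r: "range x = range y" using y(2) by (simp add: ray_graph_def)
  obtain N where N: "\<forall>i\<ge>N. x i \<notin> y ` {..<n}"
    using inj_leaves_finite_set[OF assms(2), of "y ` {..<n}"] by auto
  have "x i \<in> C" if "i \<ge> N" for i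
  proof -
    have "x i \<in> range y" unfolding r[symmetric] by simp
    then obtain k where k: "x i = y k" by blast
    have "x i \<notin> y ` {..<n}" using N that by simp
    then have "\<not> k < n" unfolding k by blast
    then have "y k \<in> range (\<lambda>i. y (n + i))" by (intro range_eqI[of _ _ "k - n"]) simp
    then have "y k \<in> vertices T" by (simp add: y(3) ray_graph_def)
    then show ?thesis using k assms(3) by auto
  qed
  then show ?thesis by blast
qed

lemma ray_equivalence_iff:
  assumes "is_ray x" "is_ray y"
  shows "(ray_graph x, ray_graph y) \<in> ray_equivalence G \<longleftrightarrow> same_end x y" (is "?L \<longleftrightarrow> ?R")
proof
  assume L: ?L
  show ?R unfolding same_end_def
  proof (intro allI impI)
    fix S assume S: "finite S \<and> S \<subseteq> V"
    have "\<exists>C\<in>graph_components (delete_vertices G S). \<exists>T T'. tail_of_ray T (ray_graph x) \<and>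
        tail_of_ray T' (ray_graph y) \<and> vertices T \<subseteq> C \<and> vertices T' \<subseteq> C"
      using L S by (simp add: ray_equivalence_def)
    then obtain C T T' where C: "C \<in> graph_components (delete_vertices G S)"
      and T: "tail_of_ray T (ray_graph x)" "vertices T \<subseteq> C"
      and T': "tail_of_ray T' (ray_graph y)" "vertices T' \<subseteq> C"
      by (elim bexE exE conjE)
    obtain N where N: "\<forall>i\<ge>N. x i \<in> C"
      using eventually_in_tail[OF T(1) _ T(2)] assms(1) by (auto simp: is_ray_def)
    obtain M where M: "\<forall>i\<ge>M. y i \<in> C"
      using eventually_in_tail[OF T'(1) _ T'(2)] assms(2) by (auto simp: is_ray_def)
    obtain c where c: "C = {v. joined_avoiding S c v}"
      using C by (auto simp: graph_components_def quotient_def joined_avoiding_def Image_def)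
    have "joined_avoiding S a b" if "a \<in> C" "b \<in> C" for a b
      using that joined_trans[OF joined_sym[of S c a]] by (simp add: c)
    then have "joined_avoiding S (x i) (y j)" if "i \<ge> max N M" "j \<ge> max N M" for i j
      using N M that by simp
    then show "\<exists>N. \<forall>i\<ge>N. \<forall>j\<ge>N. joined_avoiding S (x i) (y j)" by blast
  qed
next
  assume R: ?R
  have "\<exists>C\<in>graph_components (delete_vertices G S). \<exists>T T'. tail_of_ray T (ray_graph x) \<and>
      tail_of_ray T' (ray_graph y) \<and> vertices T \<subseteq> C \<and> vertices T' \<subseteq> C"
    if "finite S" "S \<subseteq> V" for S
  proof -
    obtain N where "\<forall>i\<ge>N. \<forall>j\<ge>N. joined_avoiding S (x i) (y j)"
      using R \<open>finite S\<close> \<open>S \<subseteq> V\<close> by (auto simp: same_end_def)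
    then have N: "joined_avoiding S (x i) (y j)" if "i \<ge> N" "j \<ge> N" for i j using that by simp
    define C where "C = {v. joined_avoiding S (x N) v}"
    have "x N \<in> vertices (delete_vertices G S)"
      using N[of N N] by (auto simp: joined_iff delete_vertices_def induced_on_def)
    then have "C \<in> graph_components (delete_vertices G S)"
      unfolding graph_components_def C_def joined_avoiding_def by (auto simp: quotient_def Image_def)
    moreover have "x (N + i) \<in> C" "y (N + i) \<in> C" for i
      using N[of N "N + i"] joined_trans[OF N[of N N] joined_sym[OF N[of "N + i" N]]]
      by (simp_all add: C_def)
    moreover have "tail_of_ray (ray_graph (\<lambda>i. z (N + i))) (ray_graph z)" if "is_ray z" for z
      unfolding tail_of_ray_def using that is_ray_def by blast
    moreover have "vertices (ray_graph (\<lambda>i. z (N + i))) \<subseteq> C" if "\<And>i. z (N + i) \<in> C" for z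
      using that by (auto simp: ray_graph_def)
    ultimately show ?thesis using assms by meson
  qed
  moreover have "ray_in G (ray_graph x)" "ray_in G (ray_graph y)"
    using assms ray_in_iff by blast+
  ultimately show ?L by (simp add: ray_equivalence_def)
qed

lemma equiv_ray_equivalence: "equiv {R. ray_in G R} (ray_equivalence G)"
proof (rule equivI)
  show "ray_equivalence G \<subseteq> {R. ray_in G R} \<times> {R. ray_in G R}"
    by (auto simp: ray_equivalence_def)
  show "refl_on {R. ray_in G R} (ray_equivalence G)"
    by (rule refl_onI) (auto simp: ray_in_iff ray_equivalence_iff same_end_refl)
  show "sym (ray_equivalence G)"
  proof (rule symI)
    fix R R' assume a: "(R, R') \<in> ray_equivalence G"
    then obtain x y where "is_ray x" "R = ray_graph x" "is_ray y" "R' = ray_graph y"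
      by (auto simp: ray_equivalence_def ray_in_iff)
    then show "(R', R) \<in> ray_equivalence G" using a by (auto simp: ray_equivalence_iff same_end_sym)
  qed
  show "trans (ray_equivalence G)"
  proof (rule transI)
    fix R R' R'' assume a: "(R, R') \<in> ray_equivalence G" "(R', R'') \<in> ray_equivalence G"
    then obtain x y z where "is_ray x" "R = ray_graph x" "is_ray y" "R' = ray_graph y"
      "is_ray z" "R'' = ray_graph z"
      by (auto simp: ray_equivalence_def ray_in_iff)
    then show "(R, R'') \<in> ray_equivalence G"
      using a by (auto simp: ray_equivalence_iff intro: same_end_trans)
  qed
qed

text \<open>
  For a given finite \<open>S\<close>, only finitely many vertices are dominated by the initial parts of \<open>p\<close> and
  \<open>q\<close> up to their last visits to \<open>S\<close>.  So \<open>x\<close> eventually meets vertices that are dominated by a tail of \<open>p\<close>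
  or \<open>q\<close> avoiding \<open>S\<close>, and joins that tail.  If \<open>S1\<close> separated \<open>x\<close> from \<open>p\<close> and \<open>S2\<close> separated it
  from \<open>q\<close>, their union would contradict this.
\<close>
lemma ray_joins_dominating_pair:
  assumes p: "is_ray p" and q: "is_ray q" and x: "is_ray x"
    and dom: "\<And>v. v \<in> V \<Longrightarrow> \<exists>i. v = p i \<or> v \<sim> p i \<or> v = q i \<or> v \<sim> q i"
  shows "same_end x p \<or> same_end x q"
proof (rule ccontr)
  assume no: "\<not> (same_end x p \<or> same_end x q)"
  obtain S1 where S1: "finite S1" "S1 \<subseteq> V" "\<nexists>N. \<forall>i\<ge>N. \<forall>j\<ge>N. joined_avoiding S1 (x i) (p j)"
    using no by (auto simp: same_end_def)
  obtain S2 where S2: "finite S2" "S2 \<subseteq> V" "\<nexists>N. \<forall>i\<ge>N. \<forall>j\<ge>N. joined_avoiding S2 (x i) (q j)"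
    using no by (auto simp: same_end_def)
  define S where "S = S1 \<union> S2"
  have fin: "finite S" using S1 S2 by (simp add: S_def)
  obtain Mp where Mp: "\<forall>i\<ge>Mp. p i \<notin> S" using inj_leaves_finite_set p fin by (meson is_ray_def)
  obtain Mq where Mq: "\<forall>i\<ge>Mq. q i \<notin> S" using inj_leaves_finite_set q fin by (meson is_ray_def)
  define M where "M = max Mp Mq"
  have M: "p i \<notin> S" "q i \<notin> S" if "i \<ge> M" for i using Mp Mq that by (auto simp: M_def)
  \<comment> \<open>The vertices from which \<open>x\<close> must have escaped: \<open>S\<close>, and all that \<open>p\<close> and \<open>q\<close> dominate before index \<open>M\<close>.\<close>
  define F where "F = S \<union> (\<Union>i<M. {p i, q i} \<union> {v. p i \<sim> v} \<union> {v. q i \<sim> v})"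
  have "finite F" using fin finite_neighbours by (simp add: F_def)
  then obtain N where N: "\<forall>i\<ge>N. x i \<notin> F" using inj_leaves_finite_set x by (meson is_ray_def)
  have xS: "x i \<notin> S" if "i \<ge> N" for i using N that by (auto simp: F_def)
  obtain j where j: "x N = p j \<or> x N \<sim> p j \<or> x N = q j \<or> x N \<sim> q j"
    using dom ray_vertices[OF x] by blast
  have "j \<ge> M"
  proof (rule ccontr)
    assume "\<not> j \<ge> M"
    then have "x N \<in> F" using j by (auto simp: F_def adj_commute)
    then show False using N by simp
  qed
  have tail: "\<exists>K. \<forall>i\<ge>K. \<forall>j\<ge>K. joined_avoiding S (x i) (r j)"
    if r: "is_ray r" "\<And>i. i \<ge> M \<Longrightarrow> r i \<notin> S" "x N = r j \<or> x N \<sim> r j" for r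
  proof -
    have "joined_avoiding S (x N) (r j)"
      using that xS[of N] ray_vertices[OF x] \<open>j \<ge> M\<close> by (metis joined_adj joined_refl order_refl)
    moreover have "joined_avoiding S (x i) (x N)" if "i \<ge> N" for i
      by (rule joined_along_tail[of N x S]) (use xS x that in auto)
    moreover have "joined_avoiding S (r j) (r k)" if "k \<ge> M" for k
      by (rule joined_along_tail[of M r S]) (use r(1,2) \<open>j \<ge> M\<close> that in auto)
    ultimately have "joined_avoiding S (x i) (r k)" if "i \<ge> max M N" "k \<ge> max M N" for i k
      using that by (meson joined_trans max.bounded_iff)
    then show ?thesis by blast
  qed
  from j tail[OF p M(1)] tail[OF q M(2)]
  consider "\<exists>K. \<forall>i\<ge>K. \<forall>j\<ge>K. joined_avoiding S (x i) (p j)" | "\<exists>K. \<forall>i\<ge>K. \<forall>j\<ge>K. joined_avoiding S (x i) (q j)"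
    by blast
  then show False
  proof cases
    case 1
    then show False using S1(3) joined_mono[of S1 S] unfolding S_def by blast
  next
    case 2
    then show False using S2(3) joined_mono[of S2 S] unfolding S_def by blast
  qed
qed

lemma graph_ends_of_dominating_pair:
  assumes p: "is_ray p" and q: "is_ray q"
    and dom: "\<And>v. v \<in> V \<Longrightarrow> \<exists>i. v = p i \<or> v \<sim> p i \<or> v = q i \<or> v \<sim> q i"
  shows "graph_ends G = {ray_equivalence G `` {ray_graph p}, ray_equivalence G `` {ray_graph q}}"
proof -
  let ?cl = "\<lambda>x. ray_equivalence G `` {ray_graph x}"
  have cl: "?cl x \<in> {?cl p, ?cl q}" if x: "is_ray x" for x
  proof -
    have "?cl x = ?cl y" if "same_end x y" "is_ray y" for y
      using equiv_class_eq[OF equiv_ray_equivalence] ray_equivalence_iff[OF x that(2)] that(1) by simp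
    moreover have "same_end x p \<or> same_end x q" by (rule ray_joins_dominating_pair[OF p q x dom])
    ultimately show ?thesis using p q by auto
  qed
  have "{R. ray_in G R} = ray_graph ` {x. is_ray x}" by (auto simp: ray_in_iff)
  then have "graph_ends G = ?cl ` {x. is_ray x}"
    unfolding graph_ends_def quotient_def by auto
  also have "\<dots> = {?cl p, ?cl q}"
  proof
    show "?cl ` {x. is_ray x} \<subseteq> {?cl p, ?cl q}" using cl by (intro image_subsetI) simp
    show "{?cl p, ?cl q} \<subseteq> ?cl ` {x. is_ray x}" using p q by simp
  qed
  finally show ?thesis .
qed

lemma one_end_if_dominated:
  assumes "is_ray p" "\<And>v. v \<in> V \<Longrightarrow> \<exists>i. v = p i \<or> v \<sim> p i"
  shows "card (graph_ends G) = 1"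
proof -
  have "graph_ends G = {ray_equivalence G `` {ray_graph p}, ray_equivalence G `` {ray_graph p}}"
    by (rule graph_ends_of_dominating_pair[OF assms(1,1)]) (use assms(2) in blast)
  then show ?thesis by simp
qed

lemma two_ends_if_dominated:
  assumes p: "is_ray p" and q: "is_ray q"
    and dom: "\<And>v. v \<in> V \<Longrightarrow> \<exists>i. v = p i \<or> v \<sim> p i \<or> v = q i \<or> v \<sim> q i"
    and "\<not> same_end p q"
  shows "card (graph_ends G) = 2"
proof -
  have "ray_in G (ray_graph q)" using q ray_in_iff by blast
  then have "ray_equivalence G `` {ray_graph p} \<noteq> ray_equivalence G `` {ray_graph q}"
    using eq_equiv_class[OF _ equiv_ray_equivalence, of "ray_graph p" "ray_graph q"]
      assms(4) ray_equivalence_iff[OF p q] by auto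
  then show ?thesis using graph_ends_of_dominating_pair[OF p q dom] by simp
qed

end

section \<open>Claws and nets\<close>

lemma claw_free_neighbours:
  assumes G: "simple_graph G" and free: "free_of claw G"
    and adj: "adjacent G c a" "adjacent G c b" "adjacent G c d"
    and ne: "a \<noteq> b" "a \<noteq> d" "b \<noteq> d"
  shows "adjacent G a b \<or> adjacent G a d \<or> adjacent G b d"
proof (rule ccontr)
  assume no: "\<not> ?thesis"
  have irr: "\<not> adjacent G v v" for v using G by (auto simp: adjacent_def simple_graph_def)
  have sym: "adjacent G u v \<longleftrightarrow> adjacent G v u" for u v by (simp add: adjacent_def insert_commute)
  have both: "adjacent G c a" "adjacent G a c" "adjacent G c b" "adjacent G b c"
    "adjacent G c d" "adjacent G d c"
    using adj sym by blast+
  have nots: "\<not> adjacent G a b" "\<not> adjacent G b a" "\<not> adjacent G a d" "\<not> adjacent G d a"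
    "\<not> adjacent G b d" "\<not> adjacent G d b"
    using no sym by blast+
  have c: "c \<noteq> a" "c \<noteq> b" "c \<noteq> d" using adj irr by auto
  have claw: "adjacent claw i j \<longleftrightarrow> {i, j} \<in> {{0, 1}, {0, 2}, {0, 3}}" for i j
    by (simp add: adjacent_def claw_def)
  define W where "W = {c, a, b, d}"
  define f :: "'a \<Rightarrow> nat" where "f v = (if v = c then 0 else if v = a then 1 else if v = b then 2 else 3)" for v
  have f: "f c = 0" "f a = 1" "f b = 2" "f d = 3" using c ne by (auto simp: f_def)
  have W: "W \<subseteq> vertices G" using adj G by (auto simp: W_def adjacent_def simple_graph_def)
  have "bij_betw f W (vertices claw)"
    unfolding bij_betw_def inj_on_def W_def claw_def using c ne by (auto simp: f)
  moreover have "adjacent (induced_on G W) u v \<longleftrightarrow> adjacent claw (f u) (f v)"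
    if "u \<in> W" "v \<in> W" for u v
  proof -
    have "adjacent (induced_on G W) u v \<longleftrightarrow> adjacent G u v"
      using that by (auto simp: adjacent_def induced_on_def)
    also have "\<dots> \<longleftrightarrow> adjacent claw (f u) (f v)"
    proof -
      have "\<forall>u\<in>W. \<forall>v\<in>W. adjacent G u v \<longleftrightarrow> adjacent claw (f u) (f v)"
        unfolding W_def using both nots irr by (simp add: f claw doubleton_eq_iff)
      then show ?thesis using that by blast
    qed
    finally show ?thesis .
  qed
  moreover have "vertices (induced_on G W) = W" using W by (auto simp: induced_on_def)
  ultimately have "graph_isomorphic (induced_on G W) claw" by (auto simp: graph_isomorphic_def)
  then show False using free W unfolding free_of_def by blast
qed

lemma net_free_triangle:
  assumes G: "simple_graph G" and free: "free_of net G"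
    and tri: "adjacent G a b" "adjacent G b c" "adjacent G a c"
    and pend: "adjacent G a x" "adjacent G b y" "adjacent G c z"
  shows "adjacent G a y \<or> adjacent G a z \<or> adjacent G b x \<or> adjacent G b z \<or> adjacent G c x \<or>
    adjacent G c y \<or> adjacent G x y \<or> adjacent G x z \<or> adjacent G y z"
proof (rule ccontr)
  assume no: "\<not> ?thesis"
  have irr: "\<not> adjacent G v v" for v using G by (auto simp: adjacent_def simple_graph_def)
  have sym: "adjacent G u v \<longleftrightarrow> adjacent G v u" for u v by (simp add: adjacent_def insert_commute)
  have both: "adjacent G a b" "adjacent G b a" "adjacent G b c" "adjacent G c b" "adjacent G a c" "adjacent G c a"
    "adjacent G a x" "adjacent G x a" "adjacent G b y" "adjacent G y b" "adjacent G c z" "adjacent G z c"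
    using tri pend sym by blast+
  have nots: "\<not> adjacent G a y" "\<not> adjacent G y a" "\<not> adjacent G a z" "\<not> adjacent G z a" "\<not> adjacent G b x" "\<not> adjacent G x b"
    "\<not> adjacent G b z" "\<not> adjacent G z b" "\<not> adjacent G c x" "\<not> adjacent G x c" "\<not> adjacent G c y" "\<not> adjacent G y c"
    "\<not> adjacent G x y" "\<not> adjacent G y x" "\<not> adjacent G x z" "\<not> adjacent G z x" "\<not> adjacent G y z" "\<not> adjacent G z y"
    using no sym by blast+
  have ne: "a \<noteq> b" "a \<noteq> c" "a \<noteq> x" "a \<noteq> y" "a \<noteq> z" "b \<noteq> c" "b \<noteq> x" "b \<noteq> y" "b \<noteq> z"
    "c \<noteq> x" "c \<noteq> y" "c \<noteq> z" "x \<noteq> y" "x \<noteq> z" "y \<noteq> z"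
    using both nots irr by blast+
  have net: "adjacent net i j \<longleftrightarrow> {i, j} \<in> {{0, 1}, {1, 2}, {0, 2}, {0, 3}, {1, 4}, {2, 5}}" for i j
    by (simp add: adjacent_def net_def)
  define W where "W = {a, b, c, x, y, z}"
  define f :: "'a \<Rightarrow> nat" where "f v = (if v = a then 0 else if v = b then 1 else if v = c then 2
    else if v = x then 3 else if v = y then 4 else 5)" for v
  have f: "f a = 0" "f b = 1" "f c = 2" "f x = 3" "f y = 4" "f z = 5"
    using ne by (simp_all add: f_def)
  have W: "W \<subseteq> vertices G" using tri pend G by (auto simp: W_def adjacent_def simple_graph_def)
  have "f ` W = {0, 1, 2, 3, 4, 5}" by (simp add: W_def f)
  moreover have "inj_on f W" unfolding inj_on_def W_def by (simp add: f)
  ultimately have "bij_betw f W (vertices net)" by (simp add: bij_betw_def net_def)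
  moreover have "adjacent (induced_on G W) u v \<longleftrightarrow> adjacent net (f u) (f v)"
    if "u \<in> W" "v \<in> W" for u v
  proof -
    have "adjacent (induced_on G W) u v \<longleftrightarrow> adjacent G u v"
      using that by (auto simp: adjacent_def induced_on_def)
    also have "\<dots> \<longleftrightarrow> adjacent net (f u) (f v)"
    proof -
      have "\<forall>u\<in>W. \<forall>v\<in>W. adjacent G u v \<longleftrightarrow> adjacent net (f u) (f v)"
        unfolding W_def using both nots irr by (simp add: f net doubleton_eq_iff)
      then show ?thesis using that by blast
    qed
    finally show ?thesis .
  qed
  moreover have "vertices (induced_on G W) = W" using W by (auto simp: induced_on_def)
  ultimately have "graph_isomorphic (induced_on G W) net" by (auto simp: graph_isomorphic_def)
  then show False using free W unfolding free_of_def by blast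
qed

section \<open>Dominating induced paths become spanning\<close>

locale claw_free = locally_finite_connected +
  assumes claw_free: "free_of claw G"
begin

lemma claw:
  assumes "c \<sim> a" "c \<sim> b" "c \<sim> d" "\<not> a \<sim> d" "\<not> b \<sim> d" "a \<noteq> b" "a \<noteq> d" "b \<noteq> d"
  shows "a \<sim> b"
  using claw_free_neighbours[OF simple claw_free assms(1-3)] assms by blast

text \<open>
  The index type is left open so that induced rays (indexed by \<open>nat\<close>) and induced double rays (indexed by
  \<open>int\<close>) are treated together.  Injectivity follows from the
  adjacencies (\<open>induced_path_inj\<close>).
\<close>
definition induced_path :: "('i :: linordered_semidom \<Rightarrow> 'a) \<Rightarrow> bool" where
  "induced_path x \<longleftrightarrow> (\<forall>i j. x i \<sim> x j \<longleftrightarrow> j = i + 1 \<or> i = j + 1)"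

definition undominated :: "('i \<Rightarrow> 'a) \<Rightarrow> 'a set" where
  "undominated x = {v \<in> V. \<forall>i. v \<noteq> x i \<and> \<not> v \<sim> x i}"

lemma induced_path_adj: "induced_path x \<Longrightarrow> x i \<sim> x j \<longleftrightarrow> j = i + 1 \<or> i = j + 1"
  by (simp add: induced_path_def)

text \<open>
  Equal vertices have equal neighbours.  From \<open>x i = x j\<close> with distinct \<open>i\<close> and \<open>j\<close> it would follow both that \<open>i\<close> is
  two ahead of \<open>j\<close> and that \<open>j\<close> is two ahead of \<open>i\<close>.
\<close>
lemma induced_path_inj:
  fixes x :: "'i :: linordered_semidom \<Rightarrow> 'a"
  assumes x: "induced_path x"
  shows "inj x"
proof (rule injI)
  fix i j assume eq: "x i = x j"
  have "x (j + 1) \<sim> x i" "x (i + 1) \<sim> x j"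
    using induced_path_adj[OF x, of "j + 1" j] induced_path_adj[OF x, of "i + 1" i] eq by simp_all
  then have "i = j \<or> i = j + 1 + 1" "i = j \<or> j = i + 1 + 1"
    unfolding induced_path_adj[OF x] by auto
  moreover have "i < i + 1 + 1" by (meson less_add_one order_less_trans)
  moreover have "j < j + 1 + 1" by (meson less_add_one order_less_trans)
  ultimately show "i = j" by (metis less_asym)
qed

lemma induced_path_vertices: "induced_path x \<Longrightarrow> x i \<in> V"
  using induced_path_adj[of x i "i + 1"] adj_vertices by blast

text \<open>
  The block of \<open>x i\<close> lists the vertices off the path whose last neighbour on it is \<open>x i\<close>, and then
  \<open>x i\<close> itself.  A last neighbour exists because degrees are finite and \<open>x\<close> is injective.  Both adjacency
  facts come from a claw at \<open>x i\<close> with leaf \<open>x (i + 1)\<close>: two members of a block must be adjacent, and a member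
  of a block must be adjacent to the preceding path vertex.  Placing \<open>x i\<close> at the end of its block makes
  the vertices that see only \<open>x 0\<close> on a ray fit in front of it without a special case.
\<close>
lemma blocks_along_path:
  fixes x :: "'i :: linordered_semidom \<Rightarrow> 'a"
  assumes x: "induced_path x" and dom: "undominated x = {}"
  obtains L :: "'i \<Rightarrow> 'a list" where "\<And>i. L i \<noteq> []" "\<And>i. distinct (L i)"
    "\<And>i j. i \<noteq> j \<Longrightarrow> set (L i) \<inter> set (L j) = {}" "\<And>i. successively (\<sim>) (L i)"
    "\<And>i. last (L i) \<sim> hd (L (i + 1))" "(\<Union>i. set (L i)) = V"
proof -
  define K where "K i = {v. v \<notin> range x \<and> v \<sim> x i \<and> (\<forall>j>i. \<not> v \<sim> x j)}" for i
  have K_fin: "finite (K i)" for i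
    using finite_neighbours[of "x i"] by (rule finite_subset[rotated]) (auto simp: K_def adj_commute)
  have next_adj: "x i \<sim> x (i + 1)" "x (i + 1) \<sim> x i" for i
    using induced_path_adj[OF x] by simp_all
  have skip: "\<not> x i \<sim> x (i + 1 + 1)" for i
  proof -
    have "i < i + 1 + 1 + 1" by (meson less_add_one order_less_trans)
    then show ?thesis unfolding induced_path_adj[OF x] by auto
  qed
  have K_clique: "u \<sim> v" if "u \<in> K i" "v \<in> K i" "u \<noteq> v" for u v i
  proof (rule claw)
    show "x i \<sim> u" "x i \<sim> v" "x i \<sim> x (i + 1)" using that next_adj by (auto simp: K_def adj_commute)
    show "\<not> u \<sim> x (i + 1)" "\<not> v \<sim> x (i + 1)" "u \<noteq> x (i + 1)" "v \<noteq> x (i + 1)"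
      using that by (auto simp: K_def)
  qed (rule that(3))
  have K_prev: "x i \<sim> v" if "v \<in> K (i + 1)" for v i
  proof (rule claw)
    show "x (i + 1) \<sim> x i" "x (i + 1) \<sim> x (i + 1 + 1)" by (rule next_adj)+
    show "x (i + 1) \<sim> v" "\<not> v \<sim> x (i + 1 + 1)" "x i \<noteq> v" "v \<noteq> x (i + 1 + 1)"
      using that by (auto simp: K_def adj_commute)
    show "\<not> x i \<sim> x (i + 1 + 1)" by (rule skip)
    have "i < i + 1 + 1" by (meson less_add_one order_less_trans)
    then show "x i \<noteq> x (i + 1 + 1)" using induced_path_inj[OF x] by (metis injD order_less_irrefl)
  qed
  have K_cover: "\<exists>i. v \<in> K i" if "v \<in> V" "v \<notin> range x" for v
  proof -
    \<comment> \<open>The indices of the neighbours of \<open>v\<close> on the path; the maximum selects the block of \<open>v\<close>.\<close>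
    define J where "J = x -` {u. v \<sim> u}"
    have "finite J" unfolding J_def using finite_neighbours induced_path_inj[OF x] by (rule finite_vimageI)
    moreover have "J \<noteq> {}" using that dom by (auto simp: undominated_def J_def)
    ultimately have max: "Max J \<in> J" "\<And>j. j \<in> J \<Longrightarrow> j \<le> Max J" by simp_all
    have mem_J: "j \<in> J \<longleftrightarrow> v \<sim> x j" for j by (simp add: J_def)
    have "\<not> v \<sim> x j" if "Max J < j" for j
    proof
      assume "v \<sim> x j"
      then have "j \<le> Max J" by (simp add: max(2) mem_J)
      then show False using that by simp
    qed
    then have "v \<in> K (Max J)" using \<open>v \<notin> range x\<close> max(1) mem_J by (simp add: K_def)
    then show ?thesis ..
  qed
  have "\<exists>l. set l = K i \<and> distinct l" for i using finite_distinct_list[OF K_fin] .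
  then obtain l where l: "\<And>i. set (l i) = K i" "\<And>i. distinct (l i)" by metis
  define L where "L i = l i @ [x i]" for i
  have set_L: "set (L i) = insert (x i) (K i)" for i by (simp add: L_def l)
  have hd_L: "x i \<sim> hd (L (i + 1))" for i
  proof (cases "l (i + 1)")
    case Nil
    then show ?thesis using next_adj by (simp add: L_def)
  next
    case (Cons v vs)
    then have "v \<in> K (i + 1)" using l(1)[of "i + 1"] by auto
    then show ?thesis using K_prev Cons by (simp add: L_def)
  qed
  show thesis
  proof
    show "L i \<noteq> []" for i by (simp add: L_def)
    show "distinct (L i)" for i using l by (auto simp: L_def K_def)
    show "set (L i) \<inter> set (L j) = {}" if "i \<noteq> j" for i j
    proof -
      have "K i \<inter> K j = {}" using that by (auto simp: K_def) (metis linorder_neqE)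
      moreover have "x i \<noteq> x j" using that induced_path_inj[OF x] by (simp add: inj_eq)
      ultimately show ?thesis unfolding set_L by (auto simp: K_def)
    qed
    show "successively (\<sim>) (L i)" for i
    proof (rule successively_if_clique)
      show "distinct (L i)" using l by (auto simp: L_def K_def)
      show "u \<sim> v" if "u \<in> set (L i)" "v \<in> set (L i)" "u \<noteq> v" for u v
        using that K_clique[of u i v] unfolding set_L by (auto simp: K_def adj_commute)
    qed
    show "last (L i) \<sim> hd (L (i + 1))" for i using hd_L by (simp add: L_def)
    show "(\<Union>i. set (L i)) = V"
    proof (intro equalityI subsetI)
      fix v assume "v \<in> (\<Union>i. set (L i))"
      then obtain i where "v = x i \<or> v \<sim> x i" unfolding set_L by (auto simp: K_def)
      then show "v \<in> V" using induced_path_vertices[OF x] adj_vertices by blast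
    next
      fix v assume "v \<in> V"
      then show "v \<in> (\<Union>i. set (L i))" using K_cover[of v] unfolding set_L by blast
    qed
  qed
qed

lemma spanning_ray:
  fixes x :: "nat \<Rightarrow> 'a"
  assumes "induced_path x" "undominated x = {}"
  shows "\<exists>R. ray_in G R \<and> spanning_in G R"
proof -
  obtain L :: "nat \<Rightarrow> 'a list" where L: "\<And>i. L i \<noteq> []" "\<And>i. distinct (L i)"
    "\<And>i j. i \<noteq> j \<Longrightarrow> set (L i) \<inter> set (L j) = {}" "\<And>i. successively (\<sim>) (L i)"
    "\<And>i. last (L i) \<sim> hd (L (i + 1))" "(\<Union>i. set (L i)) = V"
    using blocks_along_path[OF assms] by metis
  have "\<exists>f. inj f \<and> range f = (\<Union>i. set (L i)) \<and> f 0 = hd (L 0) \<and> (\<forall>n. f n \<sim> f (Suc n))"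
    by (rule ray_of_blocks) (use L in simp_all)
  then obtain f where f: "inj f" "range f = V" "\<forall>n. f n \<sim> f (Suc n)" using L(6) by auto
  then have "ray_in G (ray_graph f)" by (auto simp: ray_in_iff is_ray_def)
  moreover have "spanning_in G (ray_graph f)" using f by (simp add: spanning_in_def ray_graph_def)
  ultimately show ?thesis by blast
qed

lemma spanning_double_ray:
  fixes x :: "int \<Rightarrow> 'a"
  assumes "induced_path x" "undominated x = {}"
  shows "\<exists>D. double_ray_in G D \<and> spanning_in G D"
proof -
  obtain L :: "int \<Rightarrow> 'a list" where L: "\<And>i. L i \<noteq> []" "\<And>i. distinct (L i)"
    "\<And>i j. i \<noteq> j \<Longrightarrow> set (L i) \<inter> set (L j) = {}" "\<And>i. successively (\<sim>) (L i)"
    "\<And>i. last (L i) \<sim> hd (L (i + 1))" "(\<Union>i. set (L i)) = V"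
    using blocks_along_path[OF assms] by metis
  obtain f :: "int \<Rightarrow> 'a" where f: "inj f" "range f = V" "\<forall>n. f n \<sim> f (n + 1)"
    using double_ray_of_blocks[where L = L and E = "(\<sim>)", OF L(1-5) adj_sym] L(6) by auto
  have "subgraph_of (double_ray_graph f) G"
    using f by (auto simp: subgraph_of_def double_ray_graph_def adjacent_def)
  then have "double_ray_in G (double_ray_graph f)" using f(1) by (auto simp: double_ray_in_def)
  moreover have "spanning_in G (double_ray_graph f)"
    using f by (simp add: spanning_in_def double_ray_graph_def)
  ultimately show ?thesis by blast
qed

end

section \<open>Vertices not dominated by an induced ray\<close>

locale claw_net_free = claw_free +
  assumes net_free: "free_of net G"
begin

lemma undominated_not_adj: "w \<in> undominated x \<Longrightarrow> \<not> w \<sim> x i \<and> \<not> x i \<sim> w"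
  by (simp add: undominated_def adj_commute[of "x i"])

text \<open>
  A claw at \<open>u\<close> with leaf \<open>w\<close> shows that any two neighbours of \<open>u\<close> on \<open>x\<close> are at most one step apart
  (\<open>close\<close>).  A claw at \<open>x (i + 1)\<close> shows that with \<open>x (i + 1)\<close> also one of the vertices next to it on \<open>x\<close> is a neighbour
  of \<open>u\<close> (\<open>side\<close>).  So a neighbour beyond \<open>x 1\<close> would be part of a pair \<open>x (i + 1)\<close>, \<open>x (i + 2)\<close> of
  neighbours, and the triangle of \<open>u\<close> and this pair with the pendant vertices \<open>w\<close>, \<open>x i\<close> and \<open>x (i + 3)\<close> would be a net (\<open>no_pair\<close>).
\<close>
lemma attached_at_start:
  fixes x :: "nat \<Rightarrow> 'a"
  assumes x: "induced_path x" and w: "w \<in> undominated x" and uw: "u \<sim> w" and uj: "u \<sim> x j"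
  shows "u \<sim> x 0 \<and> j \<le> 1"
proof -
  note path = induced_path_adj[OF x]
  have x_inj: "x i = x k \<longleftrightarrow> i = k" for i k using induced_path_inj[OF x] by (simp add: inj_eq)
  have w_x: "\<not> w \<sim> x i" "\<not> x i \<sim> w" "w \<noteq> x i" for i
    using undominated_not_adj[OF w] w by (auto simp: undominated_def)
  have u_x: "u \<noteq> x i" for i using uw w_x by blast
  have close: "k \<le> i + 1" if "u \<sim> x i" "u \<sim> x k" for i k
  proof (rule ccontr)
    assume "\<not> k \<le> i + 1"
    then have "\<not> x i \<sim> x k" "x i \<noteq> x k" by (auto simp: path x_inj)
    then have "x i \<sim> x k"
      using claw[of u "x i" "x k" w] that uw w_x by auto
    then show False using \<open>\<not> x i \<sim> x k\<close> by blast
  qed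
  have side: "u \<sim> x i \<or> u \<sim> x (i + 2)" if "u \<sim> x (i + 1)" for i
  proof (rule ccontr)
    assume no: "\<not> ?thesis"
    have "x i \<sim> u"
    proof (rule claw[of "x (i + 1)" _ _ "x (i + 2)"])
      show "x (i + 1) \<sim> x i" "x (i + 1) \<sim> x (i + 2)" "\<not> x i \<sim> x (i + 2)" "x i \<noteq> x (i + 2)"
        by (simp_all add: path x_inj)
      show "x (i + 1) \<sim> u" using that by (rule adj_sym)
      show "\<not> u \<sim> x (i + 2)" using no by blast
      show "x i \<noteq> u" "u \<noteq> x (i + 2)" using u_x by metis+
    qed
    then show False using no adj_sym by blast
  qed
  have no_pair: "\<not> (u \<sim> x (i + 1) \<and> u \<sim> x (i + 2))" for i
  proof
    assume pair: "u \<sim> x (i + 1) \<and> u \<sim> x (i + 2)"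
    then have "\<not> u \<sim> x i" "\<not> u \<sim> x (i + 3)" using close[of i "i + 2"] close[of "i + 1" "i + 3"] by auto
    moreover have "x (i + 1) \<sim> x (i + 2)" "x (i + 1) \<sim> x i" "x (i + 2) \<sim> x (i + 3)"
      "\<not> x (i + 1) \<sim> x (i + 3)" "\<not> x (i + 2) \<sim> x i" "\<not> x i \<sim> x (i + 3)"
      by (simp_all add: path)
    ultimately show False
      using net_free_triangle[OF simple net_free, of u "x (i + 1)" "x (i + 2)" w "x i" "x (i + 3)"]
        pair uw w_x by blast
  qed
  have j: "i \<le> 1" if "u \<sim> x i" for i
  proof (rule ccontr)
    assume "\<not> i \<le> 1"
    then obtain k where "i = k + 2" 
      using le_Suc_ex[of 2 i] by (auto simp: add.commute)
    then show False
      using side[of "k + 1"] no_pair[of k] no_pair[of "k + 1"] that by (auto simp: numeral_eq_Suc)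
  qed
  have "j = 0 \<or> j = 1" using j[OF uj] by auto
  moreover have "u \<sim> x 0" if "u \<sim> x 1"
    using side[of 0] that j[of 2] by (auto simp: numeral_2_eq_2)
  ultimately have "u \<sim> x 0" using uj by auto
  then show ?thesis using j[OF uj] by blast
qed

definition boundary :: "'a set \<Rightarrow> 'a set" where
  "boundary U = {b. b \<notin> U \<and> (\<exists>a\<in>U. b \<sim> a)}"

text \<open>
  On a path from \<open>r\<close> to \<open>w\<close>, the vertex before the final stretch inside \<open>U\<close> is a boundary vertex.
\<close>
lemma reached_from_boundary:
  assumes "U \<subseteq> V" "r \<in> V" "r \<notin> U" "w \<in> U"
  shows "\<exists>u\<in>boundary U. (\<lambda>a b. a \<sim> b \<and> b \<in> U)\<^sup>*\<^sup>* u w"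
proof -
  have "(\<sim>)\<^sup>*\<^sup>* r w" using assms reachable by blast
  then show ?thesis using \<open>w \<in> U\<close>
  proof (induction)
    case base
    then show ?case using \<open>r \<notin> U\<close> by blast
  next
    case (step a b)
    show ?case
    proof (cases "a \<in> U")
      case True
      then obtain u where u: "u \<in> boundary U" "(\<lambda>a b. a \<sim> b \<and> b \<in> U)\<^sup>*\<^sup>* u a" using step by blast
      have "(\<lambda>a b. a \<sim> b \<and> b \<in> U)\<^sup>*\<^sup>* u b"
        using u(2) step by (intro rtranclp.rtrancl_into_rtrancl[of _ u a b]) auto
      then show ?thesis using u(1) by blast
    next
      case False
      then have "a \<in> boundary U" using step by (auto simp: boundary_def)
      moreover have "(\<lambda>a b. a \<sim> b \<and> b \<in> U)\<^sup>*\<^sup>* a b" using step by (intro r_into_rtranclp) simp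
      ultimately show ?thesis by blast
    qed
  qed
qed

lemma boundary_touches_path:
  assumes "u \<in> boundary (undominated x)"
  shows "\<exists>j. u \<sim> x j"
proof -
  obtain a where a: "a \<in> undominated x" "u \<sim> a" "u \<notin> undominated x"
    using assms by (auto simp: boundary_def)
  then have "u \<in> V" using adj_vertices by blast
  moreover have "u \<noteq> x j" for j using a(1,2) undominated_not_adj[of a x j] by auto
  ultimately show ?thesis using a(3) by (auto simp: undominated_def)
qed

lemma undominated_reached_from_boundary:
  assumes "induced_path (x :: 'i :: linordered_semidom \<Rightarrow> 'a)" "w \<in> undominated x"
  shows "\<exists>u\<in>boundary (undominated x). (\<lambda>a b. a \<sim> b \<and> b \<in> undominated x)\<^sup>*\<^sup>* u w"
proof (rule reached_from_boundary)
  show "undominated x \<subseteq> V" "x 0 \<notin> undominated x" by (auto simp: undominated_def)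
  show "x 0 \<in> V" using assms(1) by (rule induced_path_vertices)
qed (rule assms(2))

lemma boundary_touches_start:
  fixes x :: "nat \<Rightarrow> 'a"
  assumes x: "induced_path x" and u: "u \<in> boundary (undominated x)"
  shows "u \<sim> x 0" "u \<sim> x j \<Longrightarrow> j \<le> 1"
proof -
  obtain w where w: "w \<in> undominated x" "u \<sim> w" using u by (auto simp: boundary_def)
  show "u \<sim> x 0" using boundary_touches_path[OF u] attached_at_start[OF x w] by blast
  show "u \<sim> x j \<Longrightarrow> j \<le> 1" using attached_at_start[OF x w] by blast
qed

lemma finite_boundary:
  fixes x :: "nat \<Rightarrow> 'a"
  assumes "induced_path x"
  shows "finite (boundary (undominated x))"
  using finite_neighbours[of "x 0"]
  by (rule finite_subset[rotated]) (use boundary_touches_start(1)[OF assms] adj_sym in blast)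

lemma induced_pathI:
  fixes x :: "nat \<Rightarrow> 'a"
  assumes step: "\<And>i. x i \<sim> x (Suc i)" and near: "\<And>i j. x i \<sim> x j \<Longrightarrow> j \<le> Suc i"
  shows "induced_path x"
proof -
  have "x i \<sim> x j \<longleftrightarrow> j = i + 1 \<or> i = j + 1" for i j
  proof
    assume a: "x i \<sim> x j"
    then have "j \<le> Suc i" "i \<le> Suc j" "i \<noteq> j" using near adj_sym by auto
    then show "j = i + 1 \<or> i = j + 1" by auto
  next
    assume "j = i + 1 \<or> i = j + 1"
    then show "x i \<sim> x j" using step[of i] adj_sym[OF step[of j]] by auto
  qed
  then show ?thesis unfolding induced_path_def by blast
qed

lemma induced_path_Cons:
  fixes x :: "nat \<Rightarrow> 'a"
  assumes x: "induced_path x" and u: "\<And>j. u \<sim> x j \<longleftrightarrow> j = 0"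
  shows "induced_path (case_nat u x)"
  unfolding induced_path_def
  using induced_path_adj[OF x] u adj_commute[of _ u] by (auto split: nat.splits)

lemma induced_path_shift:
  fixes x :: "nat \<Rightarrow> 'a"
  assumes "induced_path x"
  shows "induced_path (\<lambda>i. x (i + k))"
  using assms by (auto simp: induced_path_def)

text \<open>
  If a boundary vertex does not see \<open>x 1\<close>, it sees only \<open>x 0\<close> and can be put in front of \<open>x\<close>, which
  loses nothing.  Otherwise every boundary vertex sees both \<open>x 0\<close> and \<open>x 1\<close>, and a boundary vertex \<open>u\<close> takes
  the place of \<open>x 0\<close>.  The vertices at risk are those adjacent to \<open>x 0\<close> and to no later vertex of \<open>x\<close>.
  Such a vertex \<open>v\<close> is a neighbour of \<open>u\<close>: otherwise the triangle \<open>x 0\<close>, \<open>u\<close>, \<open>x 1\<close> with the pendant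
  vertices \<open>v\<close>, \<open>w\<close>, \<open>x 2\<close> would be a net, where \<open>w\<close> is an undominated neighbour of \<open>u\<close>.  In both cases
  the undominated neighbours of the new first vertex become dominated.
\<close>
lemma fewer_undominated:
  fixes x :: "nat \<Rightarrow> 'a"
  assumes x: "induced_path x" and ne: "undominated x \<noteq> {}"
  shows "\<exists>y :: nat \<Rightarrow> 'a. induced_path y \<and> undominated y \<subset> undominated x"
proof -
  note start = boundary_touches_start[OF x]
  have prependable: ?thesis
    if y: "induced_path (case_nat u y)" and u: "u \<in> boundary (undominated x)"
      and sub: "undominated (case_nat u y) \<subseteq> undominated x" for u and y :: "nat \<Rightarrow> 'a"
  proof -
    obtain w where w: "w \<in> undominated x" "u \<sim> w" using u by (auto simp: boundary_def)
    then have "w \<notin> undominated (case_nat u y)"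
      using undominated_not_adj[of w "case_nat u y" 0] by auto
    then show ?thesis using y sub w(1) by blast
  qed
  obtain u where u: "u \<in> boundary (undominated x)" using undominated_reached_from_boundary[OF x] ne by blast
  show ?thesis
  proof (cases "\<exists>v\<in>boundary (undominated x). \<not> v \<sim> x 1")
    case True
    then obtain v where v: "v \<in> boundary (undominated x)" "\<not> v \<sim> x 1" by blast
    have "v \<sim> x j \<longleftrightarrow> j = 0" for j
      using start(1)[OF v(1)] start(2)[OF v(1), of j] v(2) by (auto simp: le_Suc_eq)
    then have "induced_path (case_nat v x)" by (rule induced_path_Cons[OF x])
    moreover have "undominated (case_nat v x) \<subseteq> undominated x"
      by (auto simp: undominated_def split: nat.splits)
    ultimately show ?thesis using prependable v(1) by blast
  next
    case False
    define y where "y = (\<lambda>i. x (i + 1))"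
    have y: "induced_path y" unfolding y_def by (rule induced_path_shift[OF x])
    have "u \<sim> y j \<longleftrightarrow> j = 0" for j
      using start(2)[OF u, of "j + 1"] False u by (auto simp: y_def)
    then have "induced_path (case_nat u y)" by (rule induced_path_Cons[OF y])
    moreover have "v \<in> undominated x" if v: "v \<in> undominated (case_nat u y)" for v
    proof -
      have y_v: "v \<noteq> case_nat u y i \<and> \<not> v \<sim> case_nat u y i" for i
        using v by (simp add: undominated_def)
      have v_not: "\<not> v \<sim> u" "v \<noteq> u" "\<not> v \<sim> x (Suc j)" "v \<noteq> x (Suc j)" "v \<in> V" for j
        using v y_v[of 0] y_v[of "Suc j"] by (simp_all add: y_def undominated_def)
      have "v \<noteq> x 0" using v_not(1) start(1)[OF u] adj_sym by blast
      moreover have "\<not> v \<sim> x 0"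
      proof
        assume v0: "v \<sim> x 0"
        obtain w where w: "w \<in> undominated x" "u \<sim> w" using u by (auto simp: boundary_def)
        have v_U: "v \<notin> undominated x" using v0 undominated_not_adj[of v x 0] by auto
        \<comment> \<open>An edge from \<open>v\<close> to \<open>w\<close> would make \<open>v\<close> a boundary vertex, and these all see \<open>x 1\<close>.\<close>
        have "\<not> v \<sim> w"
        proof
          assume "v \<sim> w"
          then have "v \<in> boundary (undominated x)" using v_U w(1) by (auto simp: boundary_def)
          then show False using False v_not(3)[of 0] by auto
        qed
        moreover have "\<not> u \<sim> x 2" using start(2)[OF u, of 2] by auto
        moreover have "u \<sim> x 1" using False u by blast
        moreover have "x 0 \<sim> x 1" "x 1 \<sim> x 2" "\<not> x 0 \<sim> x 2"
          using induced_path_adj[OF x] by simp_all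
        moreover have "\<not> v \<sim> x 1" "\<not> v \<sim> x 2"
          using v_not(3)[of 0] v_not(3)[of 1] by (simp_all add: numeral_2_eq_2)
        moreover note start(1)[OF u] v0 w(2) v_not(1) undominated_not_adj[OF w(1), of 0]
          undominated_not_adj[OF w(1), of 1] undominated_not_adj[OF w(1), of 2]
        ultimately show False
          using net_free_triangle[OF simple net_free, of "x 0" u "x 1" v w "x 2"] adj_sym by blast
      qed
      ultimately have "v \<noteq> x i \<and> \<not> v \<sim> x i" for i using v_not(3,4) by (cases i) simp_all
      then show ?thesis using v_not(5) by (simp add: undominated_def)
    qed
    ultimately show ?thesis using prependable u by blast
  qed
qed

lemma dominating_induced_ray_exists:
  fixes x :: "nat \<Rightarrow> 'a"
  assumes "induced_path x" "finite (undominated x)"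
  shows "\<exists>y :: nat \<Rightarrow> 'a. induced_path y \<and> undominated y = {}"
proof -
  have "finite U \<Longrightarrow> induced_path x \<Longrightarrow> undominated x = U \<Longrightarrow>
    \<exists>y :: nat \<Rightarrow> 'a. induced_path y \<and> undominated y = {}" for U and x :: "nat \<Rightarrow> 'a"
  proof (induction U arbitrary: x rule: finite_psubset_induct)
    case (psubset U)
    show ?case
    proof (cases "undominated x = {}")
      case True
      then show ?thesis using psubset.prems by blast
    next
      case False
      then obtain y :: "nat \<Rightarrow> 'a" where "induced_path y" "undominated y \<subset> undominated x"
        using fewer_undominated psubset.prems by blast
      then show ?thesis using psubset.IH[of "undominated y" y] psubset.prems(2) by simp
    qed
  qed
  then show ?thesis using assms by blast
qed

text \<open>
  Cut the double ray one step before the first neighbour of a boundary vertex \<open>u\<close>.  On the ray that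
  remains, \<open>u\<close> would have to see the start, by \<open>attached_at_start\<close>, although its first neighbour
  comes later.
\<close>
lemma induced_double_ray_dominates:
  fixes z :: "int \<Rightarrow> 'a"
  assumes z: "induced_path z"
  shows "undominated z = {}"
proof (rule ccontr)
  assume "undominated z \<noteq> {}"
  then obtain u where u: "u \<in> boundary (undominated z)" using undominated_reached_from_boundary[OF z] by blast
  then obtain w where w: "w \<in> undominated z" "u \<sim> w" by (auto simp: boundary_def)
  define J where "J = z -` {v. u \<sim> v}"
  have "finite J" unfolding J_def using finite_neighbours induced_path_inj[OF z] by (rule finite_vimageI)
  moreover have "J \<noteq> {}" using boundary_touches_path[OF u] by (auto simp: J_def)
  ultimately have J: "Min J \<in> J" "\<And>j. j \<in> J \<Longrightarrow> Min J \<le> j" by simp_all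
  define x where "x = (\<lambda>n. z (Min J - 1 + int n))"
  have "induced_path x" using z by (auto simp: induced_path_def x_def)
  moreover have "w \<in> undominated x" using w(1) by (auto simp: undominated_def x_def)
  moreover have "u \<sim> x 1" using J(1) by (simp add: x_def J_def)
  ultimately have "u \<sim> x 0" using attached_at_start w(2) by blast
  then have "Min J - 1 \<in> J" by (simp add: x_def J_def)
  then show False using J(2) by force
qed

lemma induced_path_is_ray: "induced_path x \<Longrightarrow> is_ray x"
  using induced_path_inj[of x] induced_path_adj[of x] by (simp add: is_ray_def)

lemma induced_path_join:
  fixes p q :: "nat \<Rightarrow> 'a"
  assumes p: "induced_path p" and q: "induced_path q" and pq: "\<And>m n. p m \<sim> q n \<longleftrightarrow> m = 0 \<and> n = 0"
  shows "induced_path (\<lambda>i :: int. if 0 \<le> i then p (nat i) else q (nat (- 1 - i)))"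
proof -
  have qp: "q n \<sim> p m \<longleftrightarrow> m = 0 \<and> n = 0" for m n using pq adj_commute by metis
  show ?thesis
    unfolding induced_path_def
    by (intro allI) (auto simp: induced_path_adj[OF p] induced_path_adj[OF q] pq qp)
qed

text \<open>
  The ray \<open>y\<close> starts at a boundary vertex \<open>u\<close> and then stays in \<open>U\<close>, which has no edges to \<open>x\<close>; therefore the
  only edge between \<open>y\<close> and the part \<open>p\<close> of \<open>x\<close> that is kept joins their first vertices.
\<close>
lemma two_ends_if_infinitely_many_undominated:
  fixes x :: "nat \<Rightarrow> 'a"
  assumes x: "induced_path x" and inf: "infinite (undominated x)"
  shows "card (graph_ends G) = 2 \<and> (\<exists>D. double_ray_in G D \<and> spanning_in G D)"
proof -
  define U where "U = undominated x"
  define E where "E = (\<lambda>a b. a \<sim> b \<and> b \<in> U)"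
  have "U \<subseteq> (\<Union>u\<in>boundary U. {w. E\<^sup>*\<^sup>* u w})"
    using undominated_reached_from_boundary[OF x] unfolding U_def E_def by blast
  then obtain u where u: "u \<in> boundary U" and u_inf: "infinite {w. E\<^sup>*\<^sup>* u w}"
    using inf finite_boundary[OF x] by (metis U_def finite_UN finite_subset)
  have "finite {b. E a b}" for a
    using finite_neighbours[of a] by (rule finite_subset[rotated]) (auto simp: E_def)
  then obtain y where y0: "y 0 = u" and y_step: "\<And>i. E (y i) (y (Suc i))"
    and y_near: "\<And>i j. E (y i) (y j) \<Longrightarrow> j \<le> Suc i"
    using geodesic_ray[OF _ u_inf] by metis
  have y_U: "y (Suc i) \<in> U" for i using y_step by (simp add: E_def)
  \<comment> \<open>The relation \<open>E\<close> only admits steps into \<open>U\<close>, and every vertex of \<open>y\<close> except the first is in \<open>U\<close>.\<close>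
  have y_le: "j \<le> Suc i" if "y i \<sim> y j" for i j
    using y_near[of i j] y_U[of "j - 1"] that by (cases j) (auto simp: E_def)
  have y: "induced_path y"
  proof (rule induced_pathI)
    show "y i \<sim> y (Suc i)" for i using y_step by (simp add: E_def)
  qed (rule y_le)
  \<comment> \<open>If \<open>u\<close> sees \<open>x 1\<close> as well, dropping \<open>x 0\<close> leaves \<open>u\<close> with a single neighbour on the ray.\<close>
  define k :: nat where "k = (if u \<sim> x 1 then 1 else 0)"
  define p where "p = (\<lambda>i. x (i + k))"
  have p: "induced_path p" unfolding p_def by (rule induced_path_shift[OF x])
  have up: "u \<sim> p m \<longleftrightarrow> m = 0" for m
    using boundary_touches_start[OF x u[unfolded U_def]] boundary_touches_start(2)[OF x u[unfolded U_def], of "m + k"]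
    by (auto simp: p_def k_def le_Suc_eq split: if_splits)
  have "p m \<sim> y n \<longleftrightarrow> m = 0 \<and> n = 0" for m n
  proof (cases n)
    case 0
    then show ?thesis using up y0 adj_commute by auto
  next
    case (Suc i)
    then show ?thesis using undominated_not_adj[of "y n" x "m + k"] y_U[of i] by (simp add: U_def p_def)
  qed
  then have z: "induced_path (\<lambda>i :: int. if 0 \<le> i then p (nat i) else y (nat (- 1 - i)))"
    by (rule induced_path_join[OF p y])
  then have dom: "undominated (\<lambda>i :: int. if 0 \<le> i then p (nat i) else y (nat (- 1 - i))) = {}"
    by (rule induced_double_ray_dominates)
  have "\<exists>i. v = p i \<or> v \<sim> p i \<or> v = y i \<or> v \<sim> y i" if "v \<in> V" for v
    using dom that unfolding undominated_def by (auto split: if_splits)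
  moreover have "\<not> same_end y p"
  proof
    assume "same_end y p"
    moreover have "finite (boundary U)" "boundary U \<subseteq> V"
      using finite_boundary[OF x] adj_vertices by (auto simp: U_def boundary_def)
    ultimately obtain N where "\<forall>i\<ge>N. \<forall>j\<ge>N. joined_avoiding (boundary U) (y i) (p j)"
      unfolding same_end_def by blast
    then have "joined_avoiding (boundary U) (y (Suc N)) (p N)" by simp
    then have "p N \<in> U"
      by (rule joined_stays_inside) (use y_U adj_sym in \<open>auto simp: boundary_def\<close>)
    then show False by (auto simp: U_def undominated_def p_def)
  qed
  ultimately have "card (graph_ends G) = 2"
    using two_ends_if_dominated[of p y] induced_path_is_ray[OF p] induced_path_is_ray[OF y] same_end_sym
    by blast
  then show ?thesis using spanning_double_ray[OF z dom] by blast
qed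

lemma one_end_if_finitely_many_undominated:
  fixes x :: "nat \<Rightarrow> 'a"
  assumes "induced_path x" "finite (undominated x)"
  shows "card (graph_ends G) = 1 \<and> (\<exists>R. ray_in G R \<and> spanning_in G R)"
proof -
  obtain y :: "nat \<Rightarrow> 'a" where y: "induced_path y" "undominated y = {}"
    using dominating_induced_ray_exists[OF assms] by blast
  have "card (graph_ends G) = 1"
    by (rule one_end_if_dominated[OF induced_path_is_ray[OF y(1)]]) (use y(2) in \<open>auto simp: undominated_def\<close>)
  then show ?thesis using spanning_ray[OF y] by blast
qed

lemma induced_ray_exists:
  assumes "infinite V"
  shows "\<exists>x :: nat \<Rightarrow> 'a. induced_path x"
proof -
  obtain u where "u \<in> V" using assms by (metis finite.emptyI ex_in_conv)
  then have "V \<subseteq> {w. (\<sim>)\<^sup>*\<^sup>* u w}" using reachable by blast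
  then have inf: "infinite {w. (\<sim>)\<^sup>*\<^sup>* u w}" using assms by (meson finite_subset)
  obtain x :: "nat \<Rightarrow> 'a" where "\<And>i. x i \<sim> x (Suc i)" "\<And>i j. x i \<sim> x j \<Longrightarrow> j \<le> Suc i"
    using geodesic_ray[OF finite_neighbours inf] by metis
  then have "induced_path x" by (rule induced_pathI)
  then show ?thesis by blast
qed

end

section \<open>Ends and spanning rays of claw-free and net-free graphs\<close>

theorem theorem1p2:
  fixes G :: "'a ugraph"
  assumes "simple_graph G"
    and "infinite_graph G"
    and "locally_finite_graph G"
    and "connected_graph G"
    and "free_of claw G"
    and "free_of net G"
  shows "(card (graph_ends G) = 1 \<and> (\<exists>R. ray_in G R \<and> spanning_in G R)) \<noteq>
         (card (graph_ends G) = 2 \<and> (\<exists>D. double_ray_in G D \<and> spanning_in G D))"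
proof -
  interpret claw_net_free G by unfold_locales (use assms in auto)
  obtain x :: "nat \<Rightarrow> 'a" where x: "induced_path x"
    using induced_ray_exists assms(2) by (auto simp: infinite_graph_def)
  show ?thesis
  proof (cases "finite (undominated x)")
    case True
    then show ?thesis using one_end_if_finitely_many_undominated[OF x] by simp
  next
    case False
    then show ?thesis using two_ends_if_infinitely_many_undominated[OF x] by simp
  qed
qed

end
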